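(* Let $n\ge 0$, and for $0\le k\le n$ let $\zeta_{k,n}$ denote the number of skew-symmetric $(n,n)$-clans containing exactly $k$ pairs of natural numbers. Then for every integer $0\le k\le n$, $$\zeta_{k,n}=2^{n-k}\binom{n}{k}a_k,\qquad\text{where } a_k:=\sum_{b=0}^{\lfloor k/2\rfloor}\binom{k}{2b}\frac{(2b)!}{b!},$$ so that the total number $Z_n$ of skew-symmetric $(n,n)$-clans is $$Z_n=\sum_{k=0}^n\zeta_{k,n}=\sum_{k=0}^n 2^{n-k}\binom{n}{k}a_k.$$
   Context: An $(n,n)$-clan is a string $\gamma=c_1\cdots c_{2n}$ of symbols from $\mathbb{N}\cup\{+,-\}$ such that each natural number appearing in $\gamma$ appears exactly twice, and the number of $+$'s equals the number of $-$'s. Two clans are considered equal if they have the same $\pm$ symbols in the same positions and the same sets of positions of matching pairs of natural numbers (the actual values of the natural numbers are irrelevant). The reverse of $\gamma$ is $rev(\gamma)=c_{2n}\cdots c_1$, and $-\gamma$ is obtained from $\gamma$ by interchanging all $+$ and $-$ signs. A clan is skew-symmetric if $\gamma=-rev(\gamma)$ (as clans). *)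

theory Defs
  imports Complex_Main
begin

datatype clan_symbol = Plus | Minus | Num nat

definition clan_words :: "nat \<Rightarrow> clan_symbol list set" where
  "clan_words n = {w. length w = 2 * n
      \<and> (\<forall>a. Num a \<in> set w \<longrightarrow> count_list w (Num a) = 2)
      \<and> count_list w Plus = count_list w Minus}"

definition symbol_positions :: "clan_symbol \<Rightarrow> clan_symbol list \<Rightarrow> nat set" where
  "symbol_positions s w = {i. i < length w \<and> w ! i = s}"

definition matching_pairs :: "clan_symbol list \<Rightarrow> (nat \<times> nat) set" where
  "matching_pairs w = {(i, j). i < j \<and> j < length w \<and> w ! i = w ! j \<and> (\<exists>a. w ! i = Num a)}"

definition clan_rel :: "nat \<Rightarrow> (clan_symbol list \<times> clan_symbol list) set" where
  "clan_rel n = {(v, w). v \<in> clan_words n \<and> w \<in> clan_words n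
      \<and> symbol_positions Plus v = symbol_positions Plus w
      \<and> symbol_positions Minus v = symbol_positions Minus w
      \<and> matching_pairs v = matching_pairs w}"

text \<open>An (n,n)-clan is an equivalence class of words, i.e. a word up to the actual values of the
  natural numbers in it.\<close>

definition clans :: "nat \<Rightarrow> clan_symbol list set set" where
  "clans n = clan_words n // clan_rel n"

fun negate_symbol :: "clan_symbol \<Rightarrow> clan_symbol" where
  "negate_symbol Plus = Minus"
| "negate_symbol Minus = Plus"
| "negate_symbol (Num a) = Num a"

text \<open>Reversal and negation act on a class through its representatives. The image of a class is
  again a full class (lemmas \<open>clan_reverse_in_clans\<close> and \<open>clan_negate_in_clans\<close> below), so
  comparing the images as sets is comparing clans.\<close>

definition clan_reverse :: "clan_symbol list set \<Rightarrow> clan_symbol list set" where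
  "clan_reverse C = rev ` C"

definition clan_negate :: "clan_symbol list set \<Rightarrow> clan_symbol list set" where
  "clan_negate C = map negate_symbol ` C"

definition skew_symmetric_clans :: "nat \<Rightarrow> clan_symbol list set set" where
  "skew_symmetric_clans n = {C \<in> clans n. C = clan_negate (clan_reverse C)}"

text \<open>All representatives of a clan have the same matching pairs, and classes are nonempty, so the
  universal quantifier here is equivalent to an existential one on clans.\<close>

definition has_pairs :: "nat \<Rightarrow> clan_symbol list set \<Rightarrow> bool" where
  "has_pairs k C \<longleftrightarrow> (\<forall>w\<in>C. card (matching_pairs w) = k)"

definition zeta :: "nat \<Rightarrow> nat \<Rightarrow> nat" where
  "zeta k n = card {C \<in> skew_symmetric_clans n. has_pairs k C}"

definition Z_total :: "nat \<Rightarrow> nat" where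
  "Z_total n = card (skew_symmetric_clans n)"

text \<open>The division is exact, because \<open>b!\<close> divides \<open>(2b)!\<close>.\<close>

definition a_sum :: "nat \<Rightarrow> nat" where
  "a_sum k = (\<Sum>b = 0..k div 2. (k choose (2 * b)) * (fact (2 * b) div fact b))"

lemma equiv_clan_rel: "equiv (clan_words n) (clan_rel n)"
  by (rule equivI) (auto simp: clan_rel_def refl_on_def sym_def trans_def)

lemma negate_symbol_negate_symbol [simp]: "negate_symbol (negate_symbol s) = s"
  by (cases s) auto

lemma negate_symbol_eq_iff:
  "negate_symbol s = t \<longleftrightarrow> s = negate_symbol t"
  by auto

lemma count_list_map_negate:
  "count_list (map negate_symbol w) s = count_list w (negate_symbol s)"
  by (induction w) (auto simp: negate_symbol_eq_iff)

lemma rev_in_clan_words: "w \<in> clan_words n \<Longrightarrow> rev w \<in> clan_words n"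
  by (auto simp: clan_words_def count_list_rev)

lemma negate_in_clan_words:
  assumes "w \<in> clan_words n"
  shows "map negate_symbol w \<in> clan_words n"
proof -
  have "Num x \<in> set (map negate_symbol w) \<longleftrightarrow> Num x \<in> set w" for x
    using count_list_map_negate[of w "Num x"] by (metis count_list_0_iff negate_symbol.simps(3))
  then show ?thesis
    using assms by (simp add: clan_words_def count_list_map_negate del: set_map)
qed

lemma symbol_positions_rev:
  "symbol_positions s (rev w) =
     {i. i < length w \<and> length w - Suc i \<in> symbol_positions s w}"
  by (auto simp: symbol_positions_def rev_nth)

lemma matching_pairs_rev:
  "matching_pairs (rev w) =
     {(i, j). i < j \<and> j < length w \<and> (length w - Suc j, length w - Suc i) \<in> matching_pairs w}"
  by (auto simp: matching_pairs_def rev_nth) metis+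

lemma symbol_positions_negate:
  "symbol_positions s (map negate_symbol w) = symbol_positions (negate_symbol s) w"
  by (auto simp: symbol_positions_def negate_symbol_eq_iff)

lemma matching_pairs_negate: "matching_pairs (map negate_symbol w) = matching_pairs w"
proof -
  have "negate_symbol s = negate_symbol t \<longleftrightarrow> s = t" for s t
    by (metis negate_symbol_negate_symbol)
  moreover have "(\<exists>x. negate_symbol s = Num x) \<longleftrightarrow> (\<exists>x. s = Num x)" for s
    by (cases s) auto
  ultimately show ?thesis
    unfolding matching_pairs_def by (auto cong: conj_cong)
qed

lemma clan_rel_rev: "(v, w) \<in> clan_rel n \<Longrightarrow> (rev v, rev w) \<in> clan_rel n"
  by (auto simp: clan_rel_def rev_in_clan_words symbol_positions_rev matching_pairs_rev)
     (auto simp: clan_words_def)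

lemma clan_rel_negate:
  "(v, w) \<in> clan_rel n \<Longrightarrow> (map negate_symbol v, map negate_symbol w) \<in> clan_rel n"
  by (auto simp: clan_rel_def negate_in_clan_words symbol_positions_negate matching_pairs_negate)

lemma image_involution_in_clans:
  assumes "C \<in> clans n"
    and words: "\<And>w. w \<in> clan_words n \<Longrightarrow> f w \<in> clan_words n"
    and rel: "\<And>v w. (v, w) \<in> clan_rel n \<Longrightarrow> (f v, f w) \<in> clan_rel n"
    and inv: "\<And>w. f (f w) = w"
  shows "f ` C \<in> clans n"
proof -
  obtain v where v: "v \<in> clan_words n" "C = clan_rel n `` {v}"
    using assms(1) by (auto simp: clans_def elim: quotientE)
  have "f ` C = clan_rel n `` {f v}"
  proof
    show "f ` C \<subseteq> clan_rel n `` {f v}" using v rel by auto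
    show "clan_rel n `` {f v} \<subseteq> f ` C"
    proof
      fix w assume "w \<in> clan_rel n `` {f v}"
      then have "(f (f v), f w) \<in> clan_rel n" by (intro rel) auto
      then have "f w \<in> C" using v inv by simp
      then show "w \<in> f ` C" using inv by (metis image_eqI)
    qed
  qed
  then show ?thesis using words v by (auto simp: clans_def intro: quotientI)
qed

lemma clan_reverse_in_clans: "C \<in> clans n \<Longrightarrow> clan_reverse C \<in> clans n"
  unfolding clan_reverse_def
  by (rule image_involution_in_clans) (auto simp: rev_in_clan_words clan_rel_rev)

lemma clan_negate_in_clans: "C \<in> clans n \<Longrightarrow> clan_negate C \<in> clans n"
  unfolding clan_negate_def
  by (rule image_involution_in_clans)
     (auto simp: negate_in_clan_words clan_rel_negate comp_def)

end

theory Submission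
  imports Defs
begin

text \<open>A clan is determined by the function that sends a position to its sign or to the position
  matched with it, and skew-symmetry says that this function is equivariant under the point
  reflection of the positions, up to exchanging the signs. For such functions on \<open>2n\<close> points, choose a
  point \<open>x\<close> with mirror image \<open>x'\<close>: either \<open>x\<close> carries one of two signs (and \<open>x'\<close> the other), or
  \<open>x\<close> is matched with \<open>x'\<close>, or \<open>x\<close> is matched with one of the \<open>2n - 2\<close> other points \<open>z\<close>, and then
  \<open>x'\<close> with the mirror image of \<open>z\<close>. So the number \<open>F n k\<close> of these functions with \<open>k\<close> pairs satisfies
  \<open>F n k = 2 F (n-1) k + F (n-1) (k-1) + 2 (n-1) F (n-2) (k-2)\<close>. The closed form satisfies the same
  recurrence, because \<open>a (k+2) = a (k+1) + 2 (k+1) a k\<close>.\<close>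

section \<open>The recurrence for the closed form\<close>

lemma fact_double_div_fact_Suc:
  "fact (2 * Suc b) div fact (Suc b) = 2 * (2 * b + 1) * (fact (2 * b) div fact b :: nat)"
proof -
  have "fact (2 * Suc b) = (2 * (2 * b + 1) * (fact (2 * b) div fact b)) * (fact (Suc b) :: nat)"
  proof -
    have "(fact b :: nat) dvd fact (2 * b)" by (simp add: fact_dvd)
    then obtain q where q: "fact (2 * b) = fact b * (q :: nat)" by (auto elim: dvdE)
    then have "fact (2 * b) div fact b = q" by simp
    then show ?thesis using q by (simp add: algebra_simps)
  qed
  then show ?thesis by simp
qed

text \<open>The added terms have \<open>2 * b > k\<close> and vanish. With a common index range,
  sums for different \<open>k\<close> can be compared term by term.\<close>

lemma a_sum_eq_sum_atMost:
  assumes "k div 2 \<le> m"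
  shows "a_sum k = (\<Sum>b\<le>m. (k choose (2 * b)) * (fact (2 * b) div fact b))"
  unfolding a_sum_def
  by (rule sum.mono_neutral_left) (use assms in \<open>auto simp: binomial_eq_0\<close>)

text \<open>Pascal's rule splits term \<open>b + 1\<close> on the left; absorption and the ratio of
  consecutive quotients \<open>(2b)!/b!\<close> turn one of the two parts into term \<open>b\<close>
  of \<open>a_sum k\<close>.\<close>

lemma a_sum_Suc_Suc: "a_sum (Suc (Suc k)) = a_sum (Suc k) + 2 * Suc k * a_sum k"
proof -
  let ?q = "\<lambda>b. fact (2 * b) div fact b :: nat"
  have step: "(Suc (Suc k) choose (2 * Suc b)) * ?q (Suc b)
      = (Suc k choose (2 * Suc b)) * ?q (Suc b) + 2 * Suc k * ((k choose (2 * b)) * ?q b)" for b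
  proof -
    have absorb: "(2 * b + 1) * (Suc k choose (2 * b + 1)) = Suc k * (k choose (2 * b))"
      using Suc_times_binomial_eq[of k "2 * b"] by (simp add: mult.commute)
    have "(Suc k choose (2 * b + 1)) * ?q (Suc b)
        = 2 * ((2 * b + 1) * (Suc k choose (2 * b + 1))) * ?q b"
      unfolding fact_double_div_fact_Suc by (simp only: ac_simps)
    also have "\<dots> = 2 * Suc k * ((k choose (2 * b)) * ?q b)"
      unfolding absorb by (simp only: ac_simps)
    finally have "(Suc k choose (2 * b + 1)) * ?q (Suc b) = 2 * Suc k * ((k choose (2 * b)) * ?q b)" .
    moreover have "Suc (Suc k) choose (2 * Suc b) = (Suc k choose (2 * b + 1)) + (Suc k choose (2 * Suc b))"
      by simp
    ultimately show ?thesis by (simp only: distrib_right)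
  qed
  have "a_sum (Suc (Suc k)) = (\<Sum>b\<le>Suc k. (Suc (Suc k) choose (2 * b)) * ?q b)"
    by (rule a_sum_eq_sum_atMost) simp
  also have "\<dots> = 1 + (\<Sum>b\<le>k. (Suc (Suc k) choose (2 * Suc b)) * ?q (Suc b))"
    by (subst sum.atMost_Suc_shift) simp
  also have "\<dots> = 1 + (\<Sum>b\<le>k. (Suc k choose (2 * Suc b)) * ?q (Suc b))
      + 2 * Suc k * (\<Sum>b\<le>k. (k choose (2 * b)) * ?q b)"
    unfolding step sum.distrib sum_distrib_left by simp
  also have "1 + (\<Sum>b\<le>k. (Suc k choose (2 * Suc b)) * ?q (Suc b))
      = (\<Sum>b\<le>Suc k. (Suc k choose (2 * b)) * ?q b)"
    by (subst sum.atMost_Suc_shift) simp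
  also have "\<dots> = a_sum (Suc k)"
    by (rule a_sum_eq_sum_atMost[symmetric]) simp
  also have "(\<Sum>b\<le>k. (k choose (2 * b)) * ?q b) = a_sum k"
    by (rule a_sum_eq_sum_atMost[symmetric]) simp
  finally show ?thesis .
qed

section \<open>The recurrence of the full closed form\<close>

definition skew_count :: "nat \<Rightarrow> nat \<Rightarrow> nat" where
  "skew_count n k = 2 ^ (n - k) * (n choose k) * a_sum k"

lemma skew_count_0_right: "skew_count n 0 = 2 ^ n"
  by (simp add: skew_count_def a_sum_def)

lemma skew_count_Suc_1: "skew_count (Suc n) 1 = 2 * skew_count n 1 + skew_count n 0"
  by (cases n) (simp_all add: skew_count_def a_sum_def algebra_simps)

text \<open>After Pascal's rule only the half with \<open>Suc n choose Suc k\<close> is expanded by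
  \<open>a_sum_Suc_Suc\<close>; absorption then trades the factor \<open>Suc k\<close> for
  \<open>Suc n\<close>.\<close>

lemma skew_count_Suc_Suc_Suc:
  "skew_count (Suc (Suc n)) (Suc (Suc k)) = 2 * skew_count (Suc n) (Suc (Suc k))
     + skew_count (Suc n) (Suc k) + 2 * Suc n * skew_count n k"
proof -
  \<comment> \<open>The exponents differ by one only while \<open>k < n\<close>; otherwise
    subtraction truncates, but the binomial coefficient is 0.\<close>
  have pow: "2 ^ (n - k) * (Suc n choose Suc (Suc k)) * a_sum (Suc (Suc k))
      = 2 * (2 ^ (Suc n - Suc (Suc k)) * (Suc n choose Suc (Suc k)) * a_sum (Suc (Suc k)))"
  proof (cases "Suc k \<le> n")
    case True
    then have "n - k = Suc (Suc n - Suc (Suc k))" by simp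
    then show ?thesis by simp
  qed (simp add: binomial_eq_0)
  have "2 ^ (n - k) * (Suc n choose Suc k) * (2 * Suc k * a_sum k)
      = 2 * 2 ^ (n - k) * (Suc k * (Suc n choose Suc k)) * a_sum k"
    by (simp only: ac_simps)
  also have "\<dots> = 2 * Suc n * (2 ^ (n - k) * (n choose k) * a_sum k)"
    unfolding Suc_times_binomial by (simp only: ac_simps)
  finally have link: "2 ^ (n - k) * (Suc n choose Suc k) * (2 * Suc k * a_sum k)
      = 2 * Suc n * (2 ^ (n - k) * (n choose k) * a_sum k)" .
  have "skew_count (Suc (Suc n)) (Suc (Suc k))
      = 2 ^ (n - k) * (Suc n choose Suc (Suc k)) * a_sum (Suc (Suc k))
        + 2 ^ (n - k) * (Suc n choose Suc k) * a_sum (Suc (Suc k))"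
    unfolding skew_count_def binomial_Suc_Suc[of "Suc n" "Suc k"] diff_Suc_Suc
    by (simp only: distrib_left distrib_right add.commute)
  also have "2 ^ (n - k) * (Suc n choose Suc k) * a_sum (Suc (Suc k))
      = 2 ^ (n - k) * (Suc n choose Suc k) * a_sum (Suc k)
        + 2 ^ (n - k) * (Suc n choose Suc k) * (2 * Suc k * a_sum k)"
    unfolding a_sum_Suc_Suc[of k] by (simp only: distrib_left)
  finally show ?thesis
    unfolding pow link by (simp only: skew_count_def diff_Suc_Suc add.assoc)
qed

section \<open>Counting equivariant sign and matching functions\<close>

text \<open>Stated for any set rather than an interval of positions, because the recursion deletes
  orbits and what remains is in general no interval.\<close>

definition antipodal :: "(nat \<Rightarrow> nat) \<Rightarrow> nat set \<Rightarrow> bool" where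
  "antipodal st X \<longleftrightarrow> (\<forall>i\<in>X. st i \<in> X \<and> st i \<noteq> i \<and> st (st i) = i)"

text \<open>The effect of negated reversal on code values: a number is a position here, so it is
  reflected, unlike a label under \<open>negate_symbol\<close>.\<close>

fun skew_symbol :: "(nat \<Rightarrow> nat) \<Rightarrow> clan_symbol \<Rightarrow> clan_symbol" where
  "skew_symbol st Plus = Minus"
| "skew_symbol st Minus = Plus"
| "skew_symbol st (Num j) = Num (st j)"

text \<open>A value \<open>Num j\<close> at \<open>i\<close> means that \<open>i\<close> is matched with the point \<open>j\<close>; it is not a label as in a
  word. The value \<open>Plus\<close> outside \<open>X\<close> is a dummy.\<close>

definition skew_codes :: "(nat \<Rightarrow> nat) \<Rightarrow> nat set \<Rightarrow> (nat \<Rightarrow> clan_symbol) set" where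
  "skew_codes st X = {g. (\<forall>i\<in>X. g (st i) = skew_symbol st (g i))
     \<and> (\<forall>i\<in>X. \<forall>j. g i = Num j \<longrightarrow> j \<in> X \<and> j \<noteq> i \<and> g j = Num i)
     \<and> (\<forall>i. i \<notin> X \<longrightarrow> g i = Plus)}"

definition matched :: "nat set \<Rightarrow> (nat \<Rightarrow> clan_symbol) \<Rightarrow> nat set" where
  "matched X g = {i \<in> X. \<exists>j. g i = Num j}"

text \<open>The parameter counts matched points, hence twice the number of pairs.\<close>

definition skew_codes_matching :: "(nat \<Rightarrow> nat) \<Rightarrow> nat set \<Rightarrow> nat \<Rightarrow> (nat \<Rightarrow> clan_symbol) set" where
  "skew_codes_matching st X m = {g \<in> skew_codes st X. card (matched X g) = m}"

lemma skew_codesD: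
  assumes "g \<in> skew_codes st X"
  shows "i \<in> X \<Longrightarrow> g (st i) = skew_symbol st (g i)"
    and "i \<in> X \<Longrightarrow> g i = Num j \<Longrightarrow> j \<in> X"
    and "i \<in> X \<Longrightarrow> g i = Num j \<Longrightarrow> j \<noteq> i"
    and "i \<in> X \<Longrightarrow> g i = Num j \<Longrightarrow> g j = Num i"
    and "i \<notin> X \<Longrightarrow> g i = Plus"
  using assms unfolding skew_codes_def by blast+

lemma antipodal_Diff: "antipodal st X \<Longrightarrow> antipodal st E \<Longrightarrow> antipodal st (X - E)"
  unfolding antipodal_def by (metis Diff_iff)

lemma finite_skew_codes: "finite X \<Longrightarrow> finite (skew_codes st X)"
proof -
  assume X: "finite X"
  have "skew_codes st X \<subseteq> {g. \<forall>i. (i \<in> X \<longrightarrow> g i \<in> {Plus, Minus} \<union> Num ` X) \<and> (i \<notin> X \<longrightarrow> g i = Plus)}"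
  proof (rule subsetI, clarify)
    fix g i assume "g \<in> skew_codes st X"
    then show "(i \<in> X \<longrightarrow> g i \<in> {Plus, Minus} \<union> Num ` X) \<and> (i \<notin> X \<longrightarrow> g i = Plus)"
      using skew_codesD(2,5)[of g st X i] by (cases "g i") auto
  qed
  then show ?thesis
    by (rule finite_subset) (use X in \<open>intro finite_set_of_finite_funs, auto\<close>)
qed

text \<open>\<open>E\<close> is closed under \<open>st\<close>, and partners prescribed by
  \<open>e\<close> stay in \<open>E\<close>, so nothing links \<open>E\<close> to the rest:
  extending \<open>e\<close> is a free choice of a code on \<open>X - E\<close>, and the numbers of
  matched points add.\<close>

lemma card_matching_extending:
  assumes X: "finite X" "antipodal st X" and E: "antipodal st E" "E \<subseteq> X"
    and e: "e \<in> skew_codes st E"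
  shows "card {g \<in> skew_codes_matching st X m. \<forall>i\<in>E. g i = e i}
    = (if card (matched E e) \<le> m
       then card (skew_codes_matching st (X - E) (m - card (matched E e))) else 0)"
    (is "card ?A = _")
proof -
  have split: "card (matched X g) = card (matched E e) + card (matched (X - E) g)"
    if "\<forall>i\<in>E. g i = e i" for g
  proof -
    have "matched X g = matched E e \<union> matched (X - E) g"
      using that E(2) by (auto simp: matched_def)
    moreover have "finite (matched E e)" "finite (matched (X - E) g)"
      using X(1) E(2) by (auto simp: matched_def finite_subset)
    moreover have "matched E e \<inter> matched (X - E) g = {}" by (auto simp: matched_def)
    ultimately show ?thesis by (simp add: card_Un_disjoint)
  qed
  show ?thesis
  proof (cases "card (matched E e) \<le> m")
    case False
    have "?A = {}" using split False by (fastforce simp: skew_codes_matching_def)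
    then show ?thesis using False by (simp only: card.empty if_False)
  next
    case True
    let ?B = "skew_codes_matching st (X - E) (m - card (matched E e))"
    let ?ext = "\<lambda>h. override_on h e E"
    have XE: "antipodal st (X - E)" using X(2) E(1) by (rule antipodal_Diff)
    have inj: "inj_on ?ext ?B"
    proof (rule inj_onI)
      fix h h' assume h: "h \<in> ?B" "h' \<in> ?B" "?ext h = ?ext h'"
      show "h = h'"
      proof
        \<comment> \<open>On \<open>E\<close> the override hides both functions, but there both have
          the dummy value \<open>Plus\<close>.\<close>
        fix i show "h i = h' i"
          using h fun_cong[OF h(3), of i, unfolded override_on_def]
            skew_codesD(5)[of h st "X - E" i] skew_codesD(5)[of h' st "X - E" i]
          by (cases "i \<in> E") (auto simp: skew_codes_matching_def)
      qed
    qed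
    have "?ext ` ?B = ?A"
    proof (intro set_eqI iffI)
      fix g assume "g \<in> ?ext ` ?B"
      then obtain h where h: "h \<in> ?B" and g: "g = ?ext h" by auto
      have gE: "\<forall>i\<in>E. g i = e i" and gX: "\<forall>i. i \<notin> E \<longrightarrow> g i = h i" using g by auto
      have hc: "h \<in> skew_codes st (X - E)" using h by (simp add: skew_codes_matching_def)
      have "g \<in> skew_codes st X"
        unfolding skew_codes_def mem_Collect_eq
      proof (intro conjI ballI allI impI)
        fix i assume i: "i \<in> X"
        show "g (st i) = skew_symbol st (g i)"
          using i gE gX skew_codesD(1)[OF hc, of i] skew_codesD(1)[OF e, of i] E(1) XE
          unfolding antipodal_def by (cases "i \<in> E") auto
        fix j assume j: "g i = Num j"
        show "j \<in> X" "j \<noteq> i" "g j = Num i"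
          using i j gE gX skew_codesD(2-4)[OF hc, of i j] skew_codesD(2-4)[OF e, of i j] E(2)
          by (cases "i \<in> E"; auto)+
      next
        fix i assume "i \<notin> X"
        then show "g i = Plus" using gX skew_codesD(5)[OF hc, of i] E(2) by auto
      qed
      moreover have "matched (X - E) g = matched (X - E) h" using gX by (auto simp: matched_def)
      ultimately show "g \<in> ?A"
        using gE split[OF gE] h True by (auto simp: skew_codes_matching_def)
    next
      fix g assume A: "g \<in> ?A"
      then have g: "g \<in> skew_codes st X" and gE: "\<forall>i\<in>E. g i = e i"
        by (auto simp: skew_codes_matching_def)
      define h where "h i = (if i \<in> E then Plus else g i)" for i
      have ext: "g = ?ext h" using gE by (auto simp: h_def override_on_def)
      have "h \<in> skew_codes st (X - E)"
        unfolding skew_codes_def mem_Collect_eq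
      proof (intro conjI ballI allI impI)
        fix i assume i: "i \<in> X - E"
        show "h (st i) = skew_symbol st (h i)"
          using i skew_codesD(1)[OF g, of i] XE unfolding antipodal_def by (auto simp: h_def)
        fix j assume "h i = Num j"
        then have gij: "g i = Num j" using i by (simp add: h_def)
        then have j: "j \<in> X" "j \<noteq> i" "g j = Num i" using skew_codesD(2-4)[OF g, of i j] i by auto
        \<comment> \<open>A partner in \<open>E\<close> would have its own partner, which is
          \<open>i\<close>, in \<open>E\<close> as well.\<close>
        have "j \<notin> E"
        proof
          assume "j \<in> E"
          then have "e j = Num i" using gE j by auto
          then have "i \<in> E" using skew_codesD(2)[OF e \<open>j \<in> E\<close>] by blast
          then show False using i by auto
        qed
        then show "j \<in> X - E" "j \<noteq> i" "h j = Num i" using j by (auto simp: h_def)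
      next
        fix i assume "i \<notin> X - E"
        then show "h i = Plus" using skew_codesD(5)[OF g, of i] by (auto simp: h_def)
      qed
      moreover have "matched (X - E) g = matched (X - E) h" by (auto simp: matched_def h_def)
      ultimately have "h \<in> ?B"
        using A split[OF gE] by (auto simp: skew_codes_matching_def)
      then show "g \<in> ?ext ` ?B" using ext by auto
    qed
    then show ?thesis using True card_image[OF inj] by simp
  qed
qed

text \<open>The cases are the possible values at \<open>x\<close>. Equivariance and symmetry of the
  matching force the values on the rest of the orbits involved, so each case is an instance of
  \<open>card_matching_extending\<close> using up 0, 2 or 4 matched points.\<close>

lemma card_skew_codes_matching_rec:
  assumes X: "finite X" "antipodal st X" and x: "x \<in> X"
  defines "X' \<equiv> X - {x, st x}"
  shows "card (skew_codes_matching st X m) =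
    2 * card (skew_codes_matching st X' m)
    + (if 2 \<le> m then card (skew_codes_matching st X' (m - 2)) else 0)
    + (\<Sum>z\<in>X'. if 4 \<le> m then card (skew_codes_matching st (X' - {z, st z}) (m - 4)) else 0)"
proof -
  let ?S = "skew_codes_matching st X m"
  let ?part = "\<lambda>s. {g \<in> ?S. g x = s}"
  have fin: "finite ?S" using finite_skew_codes[OF X(1)] by (simp add: skew_codes_matching_def)
  have y: "st x \<in> X" "st x \<noteq> x" "st (st x) = x" using X(2) x by (auto simp: antipodal_def)
  have E: "antipodal st {x, st x}" "{x, st x} \<subseteq> X" using x y by (auto simp: antipodal_def)
  have S_eq: "?S = ?part Plus \<union> ?part Minus \<union> ?part (Num (st x)) \<union> (\<Union>z\<in>X'. ?part (Num z))"
  proof (intro set_eqI iffI)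
    fix g assume g: "g \<in> ?S"
    show "g \<in> ?part Plus \<union> ?part Minus \<union> ?part (Num (st x)) \<union> (\<Union>z\<in>X'. ?part (Num z))"
    proof (cases "g x")
      case (Num z)
      then have "z \<in> X" "z \<noteq> x"
        using g x skew_codesD(2,3)[of g st X x z] by (auto simp: skew_codes_matching_def)
      then show ?thesis using g Num by (auto simp: X'_def)
    qed (use g in auto)
  qed auto
  have "card ?S = card (?part Plus \<union> ?part Minus \<union> ?part (Num (st x))) + card (\<Union>z\<in>X'. ?part (Num z))"
    by (subst S_eq, rule card_Un_disjoint) (use fin X(1) in \<open>auto simp: X'_def\<close>)
  also have "card (\<Union>z\<in>X'. ?part (Num z)) = (\<Sum>z\<in>X'. card (?part (Num z)))"
    by (rule card_UN_disjoint) (use fin X(1) in \<open>auto simp: X'_def\<close>)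
  also have "card (?part Plus \<union> ?part Minus \<union> ?part (Num (st x)))
      = card (?part Plus \<union> ?part Minus) + card (?part (Num (st x)))"
    by (rule card_Un_disjoint) (use fin in auto)
  also have "card (?part Plus \<union> ?part Minus) = card (?part Plus) + card (?part Minus)"
    by (rule card_Un_disjoint) (use fin in auto)
  finally have S: "card ?S = card (?part Plus) + card (?part Minus) + card (?part (Num (st x)))
      + (\<Sum>z\<in>X'. card (?part (Num z)))" .
  have skew: "g (st i) = skew_symbol st (g i)" "g i = Num j \<Longrightarrow> g j = Num i"
    if "g \<in> ?S" "i \<in> X" for g i j
    using that skew_codesD(1,4)[of g st X i] unfolding skew_codes_matching_def by blast+
  have plus: "card (?part Plus) = card (skew_codes_matching st X' m)"
  proof -
    \<comment> \<open>\<open>Plus\<close> is both the value at \<open>x\<close> and the dummy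
      outside the orbit.\<close>
    let ?e = "(\<lambda>_. Plus)(st x := Minus)"
    have e: "?e \<in> skew_codes st {x, st x}" using y by (auto simp: skew_codes_def)
    have me: "matched {x, st x} ?e = {}" by (auto simp: matched_def)
    have "g (st x) = Minus" if "g \<in> ?S" "g x = Plus" for g
      using skew(1)[OF that(1) x] that(2) y by simp
    then have pe: "?part Plus = {g \<in> ?S. \<forall>i\<in>{x, st x}. g i = ?e i}"
      using y by auto
    show ?thesis
      unfolding pe card_matching_extending[OF X E e] me X'_def by simp
  qed
  have minus: "card (?part Minus) = card (skew_codes_matching st X' m)"
  proof -
    let ?e = "(\<lambda>_. Plus)(x := Minus)"
    have e: "?e \<in> skew_codes st {x, st x}" using y by (auto simp: skew_codes_def)
    have me: "matched {x, st x} ?e = {}" by (auto simp: matched_def)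
    have "g (st x) = Plus" if "g \<in> ?S" "g x = Minus" for g
      using skew(1)[OF that(1) x] that(2) y by simp
    then have pe: "?part Minus = {g \<in> ?S. \<forall>i\<in>{x, st x}. g i = ?e i}"
      using y by auto
    show ?thesis
      unfolding pe card_matching_extending[OF X E e] me X'_def by simp
  qed
  have self: "card (?part (Num (st x))) = (if 2 \<le> m then card (skew_codes_matching st X' (m - 2)) else 0)"
  proof -
    let ?e = "(\<lambda>_. Plus)(x := Num (st x), st x := Num x)"
    have e: "?e \<in> skew_codes st {x, st x}" using y by (auto simp: skew_codes_def)
    have "matched {x, st x} ?e = {x, st x}" by (auto simp: matched_def)
    then have me: "card (matched {x, st x} ?e) = 2" using y by simp
    have "g (st x) = Num x" if "g \<in> ?S" "g x = Num (st x)" for g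
      using skew(1)[OF that(1) x] that(2) y by simp
    then have pe: "?part (Num (st x)) = {g \<in> ?S. \<forall>i\<in>{x, st x}. g i = ?e i}"
      using y by auto
    show ?thesis
      unfolding pe card_matching_extending[OF X E e] me X'_def by simp
  qed
  have link: "card (?part (Num z))
      = (if 4 \<le> m then card (skew_codes_matching st (X' - {z, st z}) (m - 4)) else 0)"
    if "z \<in> X'" for z
  proof -
    let ?E = "{x, st x, z, st z}"
    \<comment> \<open>Matching \<open>x\<close> with \<open>z\<close> forces the mirror link between
      \<open>st x\<close> and \<open>st z\<close>.\<close>
    let ?e = "(\<lambda>_. Plus)(x := Num z, z := Num x, st x := Num (st z), st z := Num (st x))"
    have z: "z \<in> X" "z \<noteq> x" "z \<noteq> st x" using that by (auto simp: X'_def)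
    then have z': "st z \<in> X" "st z \<noteq> z" "st (st z) = z" using X(2) by (auto simp: antipodal_def)
    \<comment> \<open>Applying \<open>st\<close> to either equality would give
      \<open>z = st x\<close> or \<open>z = x\<close>. So the four points are distinct.\<close>
    then have z'': "st z \<noteq> x" "st z \<noteq> st x" using y z by metis+
    have E': "antipodal st ?E" "?E \<subseteq> X" using x y z z' by (auto simp: antipodal_def)
    have e: "?e \<in> skew_codes st ?E" using y z z' z'' by (auto simp: skew_codes_def)
    have "matched ?E ?e = ?E" by (auto simp: matched_def)
    then have me: "card (matched ?E ?e) = 4" using y z z' z''
      by (simp add: eq_commute)
    have pe: "?part (Num z) = {g \<in> ?S. \<forall>i\<in>?E. g i = ?e i}"
    proof (intro set_eqI iffI)
      fix g assume "g \<in> ?part (Num z)"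
      then have g: "g \<in> ?S" "g x = Num z" by auto
      then have "g z = Num x" using skew(2) x by blast
      moreover have "g (st x) = Num (st z)" using skew(1)[OF g(1) x] g by simp
      moreover have "g (st z) = Num (st x)" using skew(1)[OF g(1) z(1)] calculation by simp
      ultimately show "g \<in> {g \<in> ?S. \<forall>i\<in>?E. g i = ?e i}" using g y z z' z'' by auto
    qed (use y z z' z'' in auto)
    have XE: "X - ?E = X' - {z, st z}" by (auto simp: X'_def)
    show ?thesis
      unfolding pe card_matching_extending[OF X E' e] me XE by simp
  qed
  show ?thesis using S plus minus self link by simp
qed

text \<open>Strong induction, since the recurrence removes one or two orbits; \<open>X\<close> is
  generalised because the remaining set depends on \<open>z\<close>.\<close>

lemma card_skew_codes_matching:
  assumes "finite X" "antipodal st X" "card X = 2 * n"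
  shows "card (skew_codes_matching st X (2 * k)) = skew_count n k"
  using assms
proof (induction n arbitrary: X k rule: less_induct)
  case (less n)
  show ?case
  proof (cases n)
    case 0
    then have "X = {}" using less.prems by simp
    then have "skew_codes_matching st X (2 * k) = (if k = 0 then {\<lambda>_. Plus} else {})"
      by (auto simp: skew_codes_matching_def skew_codes_def matched_def)
    then show ?thesis using 0 by (cases k) (auto simp: skew_count_def a_sum_def)
  next
    case (Suc p)
    then obtain x where x: "x \<in> X" using less.prems by fastforce
    define X' where "X' = X - {x, st x}"
    have y: "st x \<in> X" "st x \<noteq> x" "st (st x) = x" using less.prems x by (auto simp: antipodal_def)
    have X': "finite X'" "antipodal st X'" "card X' = 2 * p"
    proof -
      show "finite X'" using less.prems by (simp add: X'_def)
      show "antipodal st X'"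
        unfolding X'_def by (rule antipodal_Diff) (use less.prems y in \<open>auto simp: antipodal_def\<close>)
      show "card X' = 2 * p"
        unfolding X'_def using less.prems x y Suc by (subst card_Diff_subset) auto
    qed
    have IH1: "card (skew_codes_matching st X' (2 * l)) = skew_count p l" for l
      using less.IH[OF _ X'] Suc by simp
    have IH2: "card (skew_codes_matching st (X' - {z, st z}) (2 * l)) = skew_count (p - 1) l"
      if "z \<in> X'" for z l
    proof (rule less.IH)
      have z: "st z \<in> X'" "st z \<noteq> z" "st (st z) = z" using X' that by (auto simp: antipodal_def)
      show "finite (X' - {z, st z})" using X' by simp
      show "antipodal st (X' - {z, st z})"
        by (rule antipodal_Diff) (use X' z in \<open>auto simp: antipodal_def\<close>)
      show "card (X' - {z, st z}) = 2 * (p - 1)"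
        using X' z that by (subst card_Diff_subset) auto
      show "p - 1 < n" using Suc by simp
    qed
    \<comment> \<open>All \<open>2 * p\<close> choices of \<open>z\<close> contribute equally. For
      \<open>p = 0\<close> this factor makes the truncated \<open>p - 1\<close> harmless.\<close>
    have rec: "card (skew_codes_matching st X (2 * k)) = 2 * skew_count p k
        + (if 1 \<le> k then skew_count p (k - 1) else 0)
        + 2 * p * (if 2 \<le> k then skew_count (p - 1) (k - 2) else 0)"
    proof -
      have "2 * k - 2 = 2 * (k - 1)" "2 * k - 4 = 2 * (k - 2)" by auto
      then show ?thesis
        using card_skew_codes_matching_rec[OF less.prems(1,2) x, of "2 * k", folded X'_def] X'(3)
        by (simp add: IH1 IH2)
    qed
    consider "k = 0" | "k = 1" | l where "k = Suc (Suc l)"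
      by (metis One_nat_def not0_implies_Suc)
    then show ?thesis
    proof cases
      case 1 then show ?thesis using rec Suc by (simp add: skew_count_0_right)
    next
      case 2 then show ?thesis using rec Suc skew_count_Suc_1[of p] by simp
    next
      case 3
      show ?thesis
      proof (cases p)
        case 0
        \<comment> \<open>With a single orbit and at least two pairs, all binomial coefficients
          vanish.\<close>
        then show ?thesis using rec 3 Suc by (simp add: skew_count_def binomial_eq_0)
      next
        case (Suc q)
        then show ?thesis using rec 3 \<open>n = Suc p\<close> skew_count_Suc_Suc_Suc[of q l] by simp
      qed
    qed
  qed
qed

section \<open>Skew-symmetric clans as equivariant functions\<close>

lemma count_list_eq_card_symbol_positions: "count_list w s = card (symbol_positions s w)"
  unfolding symbol_positions_def count_list_eq_length_filter length_filter_conv_card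
  by (rule arg_cong[where f = card]) auto

text \<open>Replacing a label by the position of its other occurrence forgets the label names, which
  makes the code an invariant of the clan. The \<open>THE\<close> is meaningful because a label in a
  clan word occurs exactly twice.\<close>

definition pair_code :: "clan_symbol list \<Rightarrow> nat \<Rightarrow> clan_symbol" where
  "pair_code w i = (if i < length w
     then case w ! i of Num a \<Rightarrow> Num (THE j. j < length w \<and> j \<noteq> i \<and> w ! j = Num a) | s \<Rightarrow> s
     else Plus)"

lemma ex1_partner:
  assumes w: "w \<in> clan_words n" and i: "i < 2 * n" "w ! i = Num a"
  shows "\<exists>!j. j < length w \<and> j \<noteq> i \<and> w ! j = Num a"
proof -
  have len: "length w = 2 * n" using w by (simp add: clan_words_def)
  have "Num a \<in> set w" using i len by (metis nth_mem)
  then have "card (symbol_positions (Num a) w) = 2"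
    using w by (simp add: clan_words_def flip: count_list_eq_card_symbol_positions)
  then obtain p q where pq: "symbol_positions (Num a) w = {p, q}" "p \<noteq> q"
    by (auto simp: card_2_iff)
  have mem: "j < length w \<and> w ! j = Num a \<longleftrightarrow> j = p \<or> j = q" for j
    using pq(1) by (auto simp: symbol_positions_def set_eq_iff)
  have "i = p \<or> i = q" using mem[of i] i len by simp
  then show ?thesis
  proof
    assume "i = p" then show ?thesis using mem pq(2) by (intro ex1I[of _ q]) auto
  next
    assume "i = q" then show ?thesis using mem pq(2) by (intro ex1I[of _ p]) auto
  qed
qed

lemma pair_code_eq_Num:
  assumes w: "w \<in> clan_words n"
  shows "pair_code w i = Num j \<longleftrightarrow>
    i < 2 * n \<and> j < 2 * n \<and> j \<noteq> i \<and> w ! j = w ! i \<and> (\<exists>a. w ! i = Num a)"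
proof -
  have len: "length w = 2 * n" using w by (simp add: clan_words_def)
  show ?thesis
  proof (cases "\<exists>a. i < 2 * n \<and> w ! i = Num a")
    case True
    then obtain a where a: "i < 2 * n" "w ! i = Num a" by auto
    let ?P = "\<lambda>j. j < length w \<and> j \<noteq> i \<and> w ! j = Num a"
    have "The ?P = j \<longleftrightarrow> ?P j"
    proof
      assume "The ?P = j"
      then show "?P j" using theI'[OF ex1_partner[OF w a]] by simp
    next
      assume "?P j"
      then show "The ?P = j" by (rule the1_equality[OF ex1_partner[OF w a]])
    qed
    then show ?thesis using a len by (simp add: pair_code_def)
  next
    case False
    then show ?thesis using len by (auto simp: pair_code_def split: clan_symbol.split)
  qed
qed

lemma pair_code_eq_Minus: "pair_code w i = Minus \<longleftrightarrow> i \<in> symbol_positions Minus w"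
  by (auto simp: pair_code_def symbol_positions_def split: clan_symbol.split)

lemma pair_code_eq_Plus: "pair_code w i = Plus \<longleftrightarrow> length w \<le> i \<or> i \<in> symbol_positions Plus w"
  by (auto simp: pair_code_def symbol_positions_def split: clan_symbol.split)

text \<open>\<open>Plus\<close> is the only value left over, so plus signs and the dummy are covered
  together.\<close>

lemma pair_code_eqI:
  assumes "\<And>i j. f i = Num j \<longleftrightarrow> g i = Num j" "\<And>i. f i = Minus \<longleftrightarrow> g i = Minus"
  shows "f = g"
proof
  fix i show "f i = g i"
  proof (cases "f i")
    case Plus
    then have "g i \<noteq> Minus" "\<And>j. g i \<noteq> Num j" using assms(1)[of i] assms(2)[of i] by auto
    then show ?thesis using Plus by (cases "g i") auto
  qed (use assms(1)[of i] assms(2)[of i] in auto)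
qed

lemma matching_pairs_eq:
  assumes w: "w \<in> clan_words n"
  shows "matching_pairs w = {(i, j). i < j \<and> pair_code w i = Num j}"
proof -
  have "length w = 2 * n" using w by (simp add: clan_words_def)
  then show ?thesis unfolding pair_code_eq_Num[OF w] matching_pairs_def by (auto simp: eq_commute)
qed

lemma pair_code_sym:
  assumes w: "w \<in> clan_words n" and "pair_code w i = Num j"
  shows "pair_code w j = Num i"
  using assms(2) unfolding pair_code_eq_Num[OF w] by auto

text \<open>Each side recovers the other: \<open>matching_pairs\<close> lists the pairs of partners
  in increasing order, and the sign positions are fibres of the code.\<close>

lemma clan_rel_iff_pair_code:
  assumes v: "v \<in> clan_words n" and w: "w \<in> clan_words n"
  shows "(v, w) \<in> clan_rel n \<longleftrightarrow> pair_code v = pair_code w"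
proof
  have Num_iff: "pair_code u i = Num j \<longleftrightarrow> (i, j) \<in> matching_pairs u \<or> (j, i) \<in> matching_pairs u"
    if "u \<in> clan_words n" for u i j
    using pair_code_sym[OF that] pair_code_eq_Num[OF that]
    unfolding matching_pairs_eq[OF that] by (auto simp: neq_iff)
  assume "(v, w) \<in> clan_rel n"
  then show "pair_code v = pair_code w"
    by (intro pair_code_eqI)
       (simp_all add: clan_rel_def Num_iff[OF v] Num_iff[OF w] pair_code_eq_Minus)
next
  assume eq: "pair_code v = pair_code w"
  have len: "length v = 2 * n" "length w = 2 * n" using v w by (auto simp: clan_words_def)
  \<comment> \<open>The length bound cuts off the dummy \<open>Plus\<close> beyond the word.\<close>
  have "symbol_positions Plus u = {i. i < length u \<and> pair_code u i = Plus}"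
    "symbol_positions Minus u = {i. pair_code u i = Minus}" for u
    unfolding pair_code_eq_Plus pair_code_eq_Minus by (auto simp: symbol_positions_def)
  then show "(v, w) \<in> clan_rel n"
    using v w eq len by (simp add: clan_rel_def matching_pairs_eq)
qed

lemma clan_eq_pair_code_fibre:
  assumes "w \<in> clan_words n"
  shows "clan_rel n `` {w} = {v \<in> clan_words n. pair_code v = pair_code w}"
proof -
  have "v \<in> clan_words n" if "(w, v) \<in> clan_rel n" for v using that by (simp add: clan_rel_def)
  then show ?thesis using clan_rel_iff_pair_code[OF assms] by (auto simp: eq_commute)
qed

section \<open>Skew-symmetry in terms of codes\<close>

abbreviation antipode :: "nat \<Rightarrow> nat \<Rightarrow> nat" where
  "antipode n i \<equiv> 2 * n - Suc i"

lemma antipodal_antipode: "antipodal (antipode n) {..<2 * n}"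
proof -
  \<comment> \<open>Positions start at 0, so a fixed point would give
    \<open>2 * i + 1 = 2 * n\<close>, against parity.\<close>
  have "2 * n - Suc i \<noteq> i" if "i < 2 * n" for i using that by presburger
  then show ?thesis by (auto simp: antipodal_def)
qed

text \<open>Reversal moves both ends of a pair to their antipodes, and negation only swaps signs.
  The bound on \<open>i\<close> matters: beyond it truncated subtraction yields position 0.\<close>

lemma pair_code_negate_rev:
  assumes w: "w \<in> clan_words n" and i: "i < 2 * n"
  shows "pair_code (map negate_symbol (rev w)) i = skew_symbol (antipode n) (pair_code w (antipode n i))"
proof -
  let ?u = "map negate_symbol (rev w)"
  have len: "length w = 2 * n" using w by (simp add: clan_words_def)
  have u: "?u \<in> clan_words n" using w by (intro negate_in_clan_words rev_in_clan_words)
  have nth: "?u ! j = negate_symbol (w ! antipode n j)" if "j < 2 * n" for j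
    using that len by (simp add: rev_nth)
  show ?thesis
  proof (cases "w ! antipode n i")
    case (Num a)
    then have "pair_code w (antipode n i) = Num (THE j. j < length w \<and> j \<noteq> antipode n i \<and> w ! j = Num a)"
      using i len by (simp add: pair_code_def)
    then obtain j where j: "pair_code w (antipode n i) = Num j" by blast
    then have "j < 2 * n" "j \<noteq> antipode n i" "w ! j = Num a"
      using Num unfolding pair_code_eq_Num[OF w] by auto
    then have "pair_code ?u i = Num (antipode n j)"
      unfolding pair_code_eq_Num[OF u] using nth[OF i] nth[of "antipode n j"] Num i by auto
    then show ?thesis using j by simp
  qed (use nth[OF i] i len in \<open>simp_all add: pair_code_def\<close>)
qed

text \<open>Compatibility with \<open>clan_rel\<close> gives one inclusion; the other also uses that
  negated reversal is an involution on words.\<close>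

lemma negate_rev_clan_class:
  assumes w: "w \<in> clan_words n"
  shows "clan_negate (clan_reverse (clan_rel n `` {w})) = clan_rel n `` {map negate_symbol (rev w)}"
proof -
  have "v \<in> clan_negate (clan_reverse (clan_rel n `` {w}))"
    if "(map negate_symbol (rev w), v) \<in> clan_rel n" for v
  proof -
    have "(w, map negate_symbol (rev v)) \<in> clan_rel n"
      using clan_rel_negate[OF clan_rel_rev[OF that]] by (simp add: rev_map comp_def)
    moreover have "v = map negate_symbol (rev (map negate_symbol (rev v)))"
      by (simp add: rev_map comp_def)
    ultimately show ?thesis unfolding clan_negate_def clan_reverse_def by blast
  qed
  then show ?thesis
    by (auto simp: clan_negate_def clan_reverse_def intro: clan_rel_negate clan_rel_rev)
qed

text \<open>Equality of classes becomes equality of the codes of \<open>w\<close> and its negated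
  reverse, which is equivariance. The other conditions in \<open>skew_codes\<close> hold for the
  code of every clan word.\<close>

lemma skew_symmetric_class_iff:
  assumes w: "w \<in> clan_words n"
  shows "clan_rel n `` {w} \<in> skew_symmetric_clans n \<longleftrightarrow> pair_code w \<in> skew_codes (antipode n) {..<2 * n}"
proof -
  let ?u = "map negate_symbol (rev w)"
  have len: "length w = 2 * n" using w by (simp add: clan_words_def)
  have u: "?u \<in> clan_words n" using w by (intro negate_in_clan_words rev_in_clan_words)
  have "clan_rel n `` {w} \<in> clans n" using w by (simp add: clans_def quotientI)
  then have "clan_rel n `` {w} \<in> skew_symmetric_clans n \<longleftrightarrow> clan_rel n `` {w} = clan_rel n `` {?u}"
    by (simp add: skew_symmetric_clans_def negate_rev_clan_class[OF w])
  also have "\<dots> \<longleftrightarrow> (w, ?u) \<in> clan_rel n"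
    using eq_equiv_class_iff[OF equiv_clan_rel w u] .
  also have "\<dots> \<longleftrightarrow> pair_code w = pair_code ?u" by (rule clan_rel_iff_pair_code[OF w u])
  also have "\<dots> \<longleftrightarrow> (\<forall>i<2 * n. pair_code w i = pair_code ?u i)"
  proof
    assume eq: "\<forall>i<2 * n. pair_code w i = pair_code ?u i"
    show "pair_code w = pair_code ?u"
    proof
      fix i show "pair_code w i = pair_code ?u i"
      proof (cases "i < 2 * n")
        case False
        then show ?thesis using len by (simp add: pair_code_def)
      qed (use eq in auto)
    qed
  qed auto
  also have "\<dots> \<longleftrightarrow> (\<forall>i<2 * n. pair_code w i = skew_symbol (antipode n) (pair_code w (antipode n i)))"
    using pair_code_negate_rev[OF w] by simp
  \<comment> \<open>Substituting \<open>antipode n i\<close> for \<open>i\<close> swaps the two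
    sides.\<close>
  also have "\<dots> \<longleftrightarrow> (\<forall>i<2 * n. pair_code w (antipode n i) = skew_symbol (antipode n) (pair_code w i))"
  proof -
    have "antipode n i < 2 * n" "antipode n (antipode n i) = i" if "i < 2 * n" for i using that by auto
    then show ?thesis by metis
  qed
  also have "\<dots> \<longleftrightarrow> pair_code w \<in> skew_codes (antipode n) {..<2 * n}"
  proof -
    have "j \<in> {..<2 * n} \<and> j \<noteq> i \<and> pair_code w j = Num i" if "pair_code w i = Num j" for i j
      using that pair_code_sym[OF w that] unfolding pair_code_eq_Num[OF w] by auto
    moreover have "pair_code w i = Plus" if "i \<notin> {..<2 * n}" for i
      using that len by (simp add: pair_code_def)
    ultimately show ?thesis unfolding skew_codes_def by blast
  qed
  finally show ?thesis .
qed

text \<open>Partners receive a common label, and equivariance supplies the equal numbers of signs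
  that a clan word must have.\<close>

lemma ex_word_with_pair_code:
  assumes g: "g \<in> skew_codes (antipode n) {..<2 * n}"
  shows "\<exists>w\<in>clan_words n. pair_code w = g"
proof -
  \<comment> \<open>Label each pair by its smaller position.\<close>
  let ?sym = "\<lambda>i. case g i of Num j \<Rightarrow> Num (min i j) | s \<Rightarrow> s"
  define w where "w = map ?sym [0..<2 * n]"
  have len: "length w = 2 * n" by (simp add: w_def)
  have nth: "w ! i = ?sym i" if "i < 2 * n" for i
    using that by (simp add: w_def split: clan_symbol.split)
  note gD = skew_codesD[OF g, unfolded lessThan_iff]
  have Num_partner: "\<exists>j. g i = Num j \<and> a = min i j" if "i < 2 * n" "w ! i = Num a" for i a
    using that nth[of i] by (auto split: clan_symbol.splits)
  have positions: "symbol_positions (Num a) w = {i, j}" "i \<noteq> j"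
    if hyps: "i < 2 * n" "g i = Num j" "a = min i j" for a i j
  proof -
    have ij: "j < 2 * n" "j \<noteq> i" "g j = Num i" using gD(2-4)[OF hyps(1,2)] by auto
    \<comment> \<open>The label at \<open>l\<close> is a position in the pair of \<open>l\<close>
      and also in the pair of \<open>i\<close> and \<open>j\<close>; pairs sharing a point
      coincide.\<close>
    have "l = i \<or> l = j" if l: "l < 2 * n" "w ! l = Num a" for l
    proof -
      obtain m where m: "g l = Num m" "a = min l m" using Num_partner[OF l] by blast
      then have "g m = Num l" "a = l \<or> a = m" using gD(4)[OF l(1)] by (auto simp: min_def)
      moreover have "a = i \<or> a = j" using hyps(3) by (auto simp: min_def)
      ultimately show ?thesis using hyps(2) ij(3) by auto
    qed
    moreover have "w ! i = Num a" "w ! j = Num a"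
      using nth[of i] nth[of j] hyps ij by (simp_all add: min.commute)
    ultimately show "symbol_positions (Num a) w = {i, j}"
      using hyps(1) ij(1) len by (auto simp: symbol_positions_def)
    show "i \<noteq> j" using ij by simp
  qed
  have "count_list w (Num a) = 2" if a: "Num a \<in> set w" for a
  proof -
    obtain i where i: "i < 2 * n" "w ! i = Num a" using a len by (auto simp: in_set_conv_nth)
    then obtain j where "g i = Num j" "a = min i j" using Num_partner by blast
    then show ?thesis using positions[OF i(1)] by (simp add: count_list_eq_card_symbol_positions)
  qed
  moreover have "count_list w Plus = count_list w Minus"
  proof -
    have sign: "w ! i = Plus \<longleftrightarrow> g i = Plus" "w ! i = Minus \<longleftrightarrow> g i = Minus" if "i < 2 * n" for i
      using nth[OF that] by (auto split: clan_symbol.splits)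
    have opp: "g (antipode n i) = Minus" if "i < 2 * n" "g i = Plus" for i
      using gD(1)[OF that(1)] that(2) by simp
    have opp': "g (antipode n i) = Plus" if "i < 2 * n" "g i = Minus" for i
      using gD(1)[OF that(1)] that(2) by simp
    \<comment> \<open>By equivariance the reflection exchanges positions of opposite sign.\<close>
    have "bij_betw (antipode n) (symbol_positions Plus w) (symbol_positions Minus w)"
      by (rule bij_betw_byWitness[where f' = "antipode n"])
         (use len sign opp opp' in \<open>auto simp: symbol_positions_def\<close>)
    then show ?thesis
      unfolding count_list_eq_card_symbol_positions by (rule bij_betw_same_card)
  qed
  ultimately have w: "w \<in> clan_words n" using len by (simp add: clan_words_def)
  moreover have "pair_code w = g"
  proof (rule pair_code_eqI)
    fix i j
    show "pair_code w i = Num j \<longleftrightarrow> g i = Num j"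
    proof
      assume "g i = Num j"
      moreover from this have i: "i < 2 * n" using gD(5)[of i] by force
      ultimately have "symbol_positions (Num (min i j)) w = {i, j}" "i \<noteq> j" using positions by blast+
      then have "i < length w" "j < length w" "w ! i = Num (min i j)" "w ! j = Num (min i j)"
        by (auto simp: symbol_positions_def set_eq_iff)
      then show "pair_code w i = Num j"
        unfolding pair_code_eq_Num[OF w] using len \<open>i \<noteq> j\<close> by auto
    next
      assume "pair_code w i = Num j"
      then obtain a where a: "i < 2 * n" "j < 2 * n" "j \<noteq> i" "w ! i = Num a" "w ! j = Num a"
        unfolding pair_code_eq_Num[OF w] by auto
      then obtain l where l: "g i = Num l" "a = min i l" using Num_partner by blast
      then have "j \<in> {i, l}"
        using positions(1)[OF a(1)] a len by (auto simp: symbol_positions_def)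
      then show "g i = Num j" using l a by simp
    qed
    show "pair_code w i = Minus \<longleftrightarrow> g i = Minus"
    proof (cases "i < 2 * n")
      case True
      then show ?thesis using nth[OF True] len
        by (auto simp: pair_code_eq_Minus symbol_positions_def split: clan_symbol.splits)
    next
      case False
      then show ?thesis using gD(5)[of i] len by (simp add: pair_code_def)
    qed
  qed
  ultimately show ?thesis by blast
qed

text \<open>Each matched point is the smaller or the larger end of one pair; uniqueness of partners
  makes both projections injective, with disjoint images.\<close>

lemma card_matched_pair_code:
  assumes w: "w \<in> clan_words n"
  shows "card (matched {..<2 * n} (pair_code w)) = 2 * card (matching_pairs w)"
proof -
  let ?M = "matching_pairs w"
  have fin: "finite ?M"
    by (rule finite_subset[of _ "{..<length w} \<times> {..<length w}"]) (auto simp: matching_pairs_def)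
  have M: "(i, j) \<in> ?M \<longleftrightarrow> i < j \<and> pair_code w i = Num j" for i j
    by (simp add: matching_pairs_eq[OF w])
  note sym = pair_code_sym[OF w]
  have "matched {..<2 * n} (pair_code w) = fst ` ?M \<union> snd ` ?M"
  proof (intro set_eqI iffI)
    fix i assume "i \<in> matched {..<2 * n} (pair_code w)"
    then obtain j where j: "pair_code w i = Num j" by (auto simp: matched_def)
    then have "i \<noteq> j" unfolding pair_code_eq_Num[OF w] by auto
    then have "(i, j) \<in> ?M \<or> (j, i) \<in> ?M" using j sym[OF j] by (auto simp: M)
    then show "i \<in> fst ` ?M \<union> snd ` ?M" by force
  next
    fix i assume "i \<in> fst ` ?M \<union> snd ` ?M"
    then obtain j where "(i, j) \<in> ?M \<or> (j, i) \<in> ?M" by force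
    then have "pair_code w i = Num j" using sym[of j i] by (auto simp: M)
    then show "i \<in> matched {..<2 * n} (pair_code w)"
      using pair_code_eq_Num[OF w, of i j] by (auto simp: matched_def)
  qed
  moreover have "fst ` ?M \<inter> snd ` ?M = {}"
  proof -
    have False if "(i, j) \<in> ?M" "(l, i) \<in> ?M" for i j l
      using that sym[of l i] by (auto simp: M)
    then show ?thesis by auto
  qed
  moreover have "inj_on fst ?M" by (auto simp: inj_on_def M)
  moreover have "inj_on snd ?M"
  proof -
    have "i = l" if "(i, j) \<in> ?M" "(l, j) \<in> ?M" for i j l
      using that sym[of i j] sym[of l j] by (simp add: M)
    then show ?thesis by (auto simp: inj_on_def)
  qed
  ultimately show ?thesis using fin by (simp add: card_Un_disjoint card_image)
qed

section \<open>The bijection between codes and skew-symmetric clans\<close>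

definition code_clan :: "nat \<Rightarrow> (nat \<Rightarrow> clan_symbol) \<Rightarrow> clan_symbol list set" where
  "code_clan n g = {w \<in> clan_words n. pair_code w = g}"

text \<open>Clans are the fibres of \<open>pair_code\<close>. Injectivity holds because every fibre
  over a skew code contains a word.\<close>

lemma bij_betw_code_clan:
  "bij_betw (code_clan n) (skew_codes (antipode n) {..<2 * n}) (skew_symmetric_clans n)"
proof (rule bij_betw_imageI)
  show "inj_on (code_clan n) (skew_codes (antipode n) {..<2 * n})"
  proof (rule inj_onI)
    fix g h assume g: "g \<in> skew_codes (antipode n) {..<2 * n}" and eq: "code_clan n g = code_clan n h"
    obtain w where "w \<in> clan_words n" "pair_code w = g" using ex_word_with_pair_code[OF g] by blast
    then show "g = h" using eq unfolding code_clan_def by blast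
  qed
  show "code_clan n ` skew_codes (antipode n) {..<2 * n} = skew_symmetric_clans n"
  proof (intro set_eqI iffI)
    fix C assume "C \<in> code_clan n ` skew_codes (antipode n) {..<2 * n}"
    then obtain g where g: "g \<in> skew_codes (antipode n) {..<2 * n}" "C = code_clan n g" by blast
    obtain w where w: "w \<in> clan_words n" "pair_code w = g" using ex_word_with_pair_code[OF g(1)] by blast
    then have "C = clan_rel n `` {w}" using g by (simp add: clan_eq_pair_code_fibre code_clan_def)
    then show "C \<in> skew_symmetric_clans n" using skew_symmetric_class_iff[OF w(1)] w g by simp
  next
    fix C assume C: "C \<in> skew_symmetric_clans n"
    then have "C \<in> clan_words n // clan_rel n" by (simp add: skew_symmetric_clans_def clans_def)
    then obtain w where w: "w \<in> clan_words n" "C = clan_rel n `` {w}" by (rule quotientE)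
    then have "C = code_clan n (pair_code w)" by (simp add: clan_eq_pair_code_fibre code_clan_def)
    moreover have "pair_code w \<in> skew_codes (antipode n) {..<2 * n}"
      using skew_symmetric_class_iff[OF w(1)] C w(2) by simp
    ultimately show "C \<in> code_clan n ` skew_codes (antipode n) {..<2 * n}" by blast
  qed
qed

text \<open>Nonemptiness of the class matters: otherwise the universal quantifier in
  \<open>has_pairs\<close> would hold vacuously for every \<open>k\<close>.\<close>

lemma has_pairs_code_clan:
  assumes g: "g \<in> skew_codes (antipode n) {..<2 * n}"
  shows "has_pairs k (code_clan n g) \<longleftrightarrow> card (matched {..<2 * n} g) = 2 * k"
proof -
  have "code_clan n g \<noteq> {}" using ex_word_with_pair_code[OF g] by (auto simp: code_clan_def)
  moreover have "card (matched {..<2 * n} g) = 2 * card (matching_pairs w)" if "w \<in> code_clan n g" for w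
    using that card_matched_pair_code[of w n] by (auto simp: code_clan_def)
  ultimately show ?thesis unfolding has_pairs_def by fastforce
qed

lemma zeta_eq_card_skew_codes_matching:
  "zeta k n = card (skew_codes_matching (antipode n) {..<2 * n} (2 * k))"
proof -
  have "bij_betw (code_clan n) {g \<in> skew_codes (antipode n) {..<2 * n}. card (matched {..<2 * n} g) = 2 * k}
      {C \<in> skew_symmetric_clans n. has_pairs k C}"
    by (rule bij_betw_Collect[OF bij_betw_code_clan]) (simp add: has_pairs_code_clan)
  then show ?thesis
    unfolding zeta_def skew_codes_matching_def by (rule bij_betw_same_card[symmetric])
qed

text \<open>A word realising the code shows that the number of matched points is even, and it is at
  most \<open>2 * n\<close>; so the codes split disjointly according to \<open>k\<close> from 0 to
  \<open>n\<close>.\<close>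

lemma Z_total_eq_sum_zeta: "Z_total n = (\<Sum>k=0..n. zeta k n)"
proof -
  let ?X = "{..<2 * n}"
  let ?V = "skew_codes (antipode n) ?X"
  have "\<exists>k\<in>{0..n}. card (matched ?X g) = 2 * k" if g: "g \<in> ?V" for g
  proof -
    obtain w where w: "w \<in> clan_words n" "pair_code w = g" using ex_word_with_pair_code[OF g] by blast
    have "card (matched ?X g) \<le> card ?X" by (rule card_mono) (auto simp: matched_def)
    then show ?thesis using card_matched_pair_code[OF w(1)] w(2) by auto
  qed
  then have "?V = (\<Union>k\<in>{0..n}. skew_codes_matching (antipode n) ?X (2 * k))"
    unfolding skew_codes_matching_def by blast
  moreover have "card (\<Union>k\<in>{0..n}. skew_codes_matching (antipode n) ?X (2 * k))
      = (\<Sum>k=0..n. card (skew_codes_matching (antipode n) ?X (2 * k)))"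
    by (rule card_UN_disjoint) (auto simp: skew_codes_matching_def finite_skew_codes)
  ultimately have "card ?V = (\<Sum>k=0..n. zeta k n)"
    by (simp add: zeta_eq_card_skew_codes_matching)
  then show ?thesis using bij_betw_same_card[OF bij_betw_code_clan] by (simp add: Z_total_def)
qed

theorem theorem3p4:
  fixes n :: nat
  shows "(\<forall>k\<le>n. zeta k n = 2 ^ (n - k) * (n choose k) * a_sum k)
    \<and> Z_total n = (\<Sum>k=0..n. zeta k n)
    \<and> (\<Sum>k=0..n. zeta k n) = (\<Sum>k=0..n. 2 ^ (n - k) * (n choose k) * a_sum k)"
proof -
  have "zeta k n = 2 ^ (n - k) * (n choose k) * a_sum k" for k
    unfolding zeta_eq_card_skew_codes_matching
    using card_skew_codes_matching[OF _ antipodal_antipode, of n n k] by (simp add: skew_count_def)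
  then show ?thesis by (simp add: Z_total_eq_sum_zeta)
qed

end
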